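(* Let $\mathbb{F}$ be a field in which every quadratic and every cubic polynomial has a root. With $Id(A)$ the set of all idempotents of the algebra with matrix of structure constants $A$, and the families as in the context (parameters in $\mathbb{F}$), the following hold. (I) Let $\mathrm{Char}(\mathbb{F})\neq2,3$. Then - $Id(A_4(0,\beta_2))=Id(A_5(\alpha_1))=Id(A_8(0))=Id(A_9)=Id(A_{12})=\emptyset$; - $Id(A_3(0,-1))=\{-e_2\}$; - $Id(A_3(0,\beta_2))=\{-e_2,\ \frac{3}{2(\beta_2+1)}e_1+\frac12e_2\}$, where $\beta_2\neq-1$; - $Id(A_3(\beta_1,\beta_2))=\Big\{-e_2,\ \frac{3}{\beta_2+1-\sqrt{(\beta_2+1)^2+12\beta_1}}e_1+\frac12e_2,\ \frac{3}{\beta_2+1+\sqrt{(\beta_2+1)^2+12\beta_1}}e_1+\frac12e_2\Big\}$, where $\beta_1\neq0$; - $Id(A_4(\alpha_1,\beta_2))=\{\frac1{\alpha_1}e_1\}$, where $\alpha_1\neq0$, $\beta_2\neq2\alpha_1-1$; - $Id(A_4(\alpha_1,2\alpha_1-1))=\{\frac1{\alpha_1}e_1+te_2:\ t\in\mathbb{F}\}$, where $\alpha_1\neq0$; - $Id(A_7(0))=\{-e_2,\ \frac32e_1+\frac12e_2\}$; - $Id(A_7(\beta_1))=\Big\{-e_2,\ \frac{3}{1-\sqrt{12\beta_1+1}}e_1+\frac12e_2,\ \frac{3}{1+\sqrt{12\beta_1+1}}e_1+\frac12e_2\Big\}$, where $\beta_1\neq0$; - $Id(A_8(\alpha_1))=\{\frac1{\alpha_1}e_1\}$,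 where $\alpha_1(3\alpha_1-1)\neq0$; - $Id(A_8(\frac13))=\{3e_1+te_2:\ t\in\mathbb{F}\}$; - $Id(A_{10})=\{-e_2\}$; - $Id(A_{11})=\{-e_2,\ \frac{\sqrt3}{2}e_1+\frac12e_2,\ -\frac{\sqrt3}{2}e_1+\frac12e_2\}$. (II) Let $\mathrm{Char}(\mathbb{F})=2$. Then - $Id(A_{4,2}(0,\beta_2))=Id(A_{5,2}(\alpha_1))=Id(A_{8,2}(0))=Id(A_{9,2})=Id(A_{12,2})=\emptyset$; - $Id(A_{3,2}(0,\beta_2))=\{e_2\}$; - $Id(A_{3,2}(\alpha_1,1))=\{e_2,\ \frac1{\alpha_1}e_1\}$, where $\alpha_1\neq0$; - $Id(A_{3,2}(\alpha_1,\beta_2))=\{e_2,\ \frac1{\alpha_1}e_1,\ \frac1{\alpha_1}(e_1+(\beta_2+1)e_2)\}$, where $\beta_2\neq1$, $\alpha_1\neq0$; - $Id(A_{4,2}(\alpha_1,\beta_2))=\{\frac1{\alpha_1}e_1\}$, where $\alpha_1\neq0$, $\beta_2\neq1$; - $Id(A_{4,2}(\alpha_1,1))=\{\frac1{\alpha_1}e_1+te_2:\ t\in\mathbb{F}\}$, where $\alpha_1\neq0$; - $Id(A_{7,2}(0))=\{-e_2\}$; - $Id(A_{7,2}(1))=\{e_1,-e_2\}$; - $Id(A_{7,2}(\alpha_1))=\{\frac1{\alpha_1}e_1,\ \frac1{\alpha_1}e_1+\frac{1-\alpha_1}{\alpha_1}e_2\}$, where $\alpha_1\neq0,1$; - $Id(A_{8,2}(\alpha_1))=\{\frac1{\alpha_1}e_1\}$,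 where $\alpha_1\neq0,1$; - $Id(A_{8,2}(1))=\{e_1+te_2:\ t\in\mathbb{F}\}$; - $Id(A_{10,2})=\{e_2\}$; - $Id(A_{11,2})=\{e_1,\ -e_1+e_2,\ -e_2\}$. (III) Let $\mathrm{Char}(\mathbb{F})=3$. Then - $Id(A_{4,3}(0,\beta_2))=Id(A_{5,3}(\alpha_1))=Id(A_{8,3}(0))=Id(A_{11,3})=Id(A_{12,3})=\emptyset$; - $Id(A_{3,3}(0,\beta_2))=\{-e_2\}$, where $\beta_2\neq-1$; - $Id(A_{3,3}(\beta_1,\beta_2))=\{\frac{1+\beta_2}{\beta_1}e_1-e_2,\ -e_2\}$, where $\beta_1\neq0$; - $Id(A_{3,3}(0,-1))=\{te_1+\frac12e_2,\ -e_2:\ t\in\mathbb{F}\}$; - $Id(A_{4,3}(\alpha_1,\beta_2))=\{\frac1{\alpha_1}e_1\}$, where $\alpha_1\neq0$, $\beta_2\neq2\alpha_1-1$; - $Id(A_{4,3}(\alpha_1,2\alpha_1-1))=\{\frac1{\alpha_1}e_1+te_2:\ t\in\mathbb{F}\}$, where $\alpha_1\neq0$; - $Id(A_{7,3}(0))=\{-e_2\}$; - $Id(A_{7,3}(\beta_1))=\{\frac1{\beta_1}e_1-e_2,\ -e_2\}$, where $\beta_1\neq0$; - $Id(A_{8,3}(\alpha_1))=\{\frac1{\alpha_1}e_1\}$, where $\alpha_1\neq0$; - $Id(A_{9,3})=\{-e_2\}$; - $Id(A_{10,3})=\{te_1-e_2:\ t\in\mathbb{F}\}$.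
   Context: An algebra is a vector space with a bilinear product (not necessarily associative, commutative or unital). An idempotent is a nonzero element $\mathbf v$ with $\mathbf v^2=\mathbf v$. A two-dimensional algebra with basis $e_1,e_2$ is identified with its matrix of structure constants (MSC) $A=\begin{pmatrix}\alpha_1&\alpha_2&\alpha_3&\alpha_4\\ \beta_1&\beta_2&\beta_3&\beta_4\end{pmatrix}$, meaning $e_1e_1=\alpha_1e_1+\beta_1e_2$, $e_1e_2=\alpha_2e_1+\beta_2e_2$, $e_2e_1=\alpha_3e_1+\beta_3e_2$, $e_2e_2=\alpha_4e_1+\beta_4e_2$. $\sqrt z$ denotes a square root of $z$ in $\mathbb{F}$. Families for $\mathrm{Char}(\mathbb{F})\ne2,3$: $A_3(\beta_1,\beta_2)=\begin{pmatrix}0&1&1&0\\ \beta_1&\beta_2&1&-1\end{pmatrix}$, $A_4(\alpha_1,\beta_2)=\begin{pmatrix}\alpha_1&0&0&0\\ 0&\beta_2&1-\alpha_1&0\end{pmatrix}$, $A_5(\alpha_1)=\begin{pmatrix}\alpha_1&0&0&0\\ 1&2\alpha_1-1&1-\alpha_1&0\end{pmatrix}$, $A_7(\beta_1)=\begin{pmatrix}0&1&1&0\\ \beta_1&1&0&-1\end{pmatrix}$, $A_8(\alpha_1)=\begin{pmatrix}\alpha_1&0&0&0\\ 0&1-\alpha_1&-\alpha_1&0\end{pmatrix}$, $A_9=\begin{pmatrix}\frac13&0&0&0\\ 1&\frac23&-\frac13&0\end{pmatrix}$, $A_{10}=\begin{pmatrix}0&1&1&0\\ 0&0&0&-1\end{pmatrix}$,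 $A_{11}=\begin{pmatrix}0&1&1&0\\ 1&0&0&-1\end{pmatrix}$, $A_{12}=\begin{pmatrix}0&0&0&0\\ 1&0&0&0\end{pmatrix}$. Families for $\mathrm{Char}(\mathbb{F})=2$: $A_{3,2}(\alpha_1,\beta_2)=\begin{pmatrix}\alpha_1&1&1&0\\ 0&\beta_2&1-\alpha_1&1\end{pmatrix}$, $A_{4,2}(\alpha_1,\beta_2)=\begin{pmatrix}\alpha_1&0&0&0\\ 0&\beta_2&1-\alpha_1&0\end{pmatrix}$, $A_{5,2}(\alpha_1)=\begin{pmatrix}\alpha_1&0&0&0\\ 1&1&1-\alpha_1&0\end{pmatrix}$, $A_{7,2}(\alpha_1)=\begin{pmatrix}\alpha_1&1&1&0\\ 0&1-\alpha_1&-\alpha_1&-1\end{pmatrix}$, $A_{8,2}(\alpha_1)=\begin{pmatrix}\alpha_1&0&0&0\\ 0&1-\alpha_1&-\alpha_1&0\end{pmatrix}$, $A_{9,2}=\begin{pmatrix}1&0&0&0\\ 1&0&1&0\end{pmatrix}$, $A_{10,2}=\begin{pmatrix}0&1&1&0\\ 0&0&0&-1\end{pmatrix}$, $A_{11,2}=\begin{pmatrix}1&1&1&0\\ 0&-1&-1&-1\end{pmatrix}$, $A_{12,2}=\begin{pmatrix}0&0&0&0\\ 1&0&0&0\end{pmatrix}$. Families for $\mathrm{Char}(\mathbb{F})=3$: $A_{3,3}(\beta_1,\beta_2)=\begin{pmatrix}0&1&1&0\\ \beta_1&\beta_2&1&-1\end{pmatrix}$, $A_{4,3}(\alpha_1,\beta_2)=\begin{pmatrix}\alpha_1&0&0&0\\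 0&\beta_2&1-\alpha_1&0\end{pmatrix}$, $A_{5,3}(\alpha_1)=\begin{pmatrix}\alpha_1&0&0&0\\ 1&-1-\alpha_1&1-\alpha_1&0\end{pmatrix}$, $A_{7,3}(\beta_1)=\begin{pmatrix}0&1&1&0\\ \beta_1&1&0&-1\end{pmatrix}$, $A_{8,3}(\alpha_1)=\begin{pmatrix}\alpha_1&0&0&0\\ 0&1-\alpha_1&-\alpha_1&0\end{pmatrix}$, $A_{9,3}=\begin{pmatrix}0&1&1&0\\ 1&0&0&-1\end{pmatrix}$, $A_{10,3}=\begin{pmatrix}0&1&1&0\\ 0&0&0&-1\end{pmatrix}$, $A_{11,3}=\begin{pmatrix}1&0&0&0\\ 1&-1&-1&0\end{pmatrix}$, $A_{12,3}=\begin{pmatrix}0&0&0&0\\ 1&0&0&0\end{pmatrix}$.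
   Formalization: In part (II), for α1 ≠ 0,1, the set Id(A_{7,2}(α1)) is corrected to {-e2, (1/α1)e1, (1/α1)e1 + ((1-α1)/α1)e2}: the printed set omits -e2, which is always an idempotent because e2e2 = -e2. *)

theory Defs
  imports "HOL-Analysis.Analysis"
begin

definition e1 :: "'a::field ^ 2" where "e1 = axis 1 1"

definition e2 :: "'a::field ^ 2" where "e2 = axis 2 1"

(* Coordinates with respect to the basis e1 \<otimes> e1, e1 \<otimes> e2, e2 \<otimes> e1, e2 \<otimes> e2,
   which index the four columns of a matrix of structure constants. *)
definition kron :: "'a::field ^ 2 \<Rightarrow> 'a ^ 2 \<Rightarrow> 'a ^ 4" where
  "kron u v = vector [u $ 1 * v $ 1, u $ 1 * v $ 2, u $ 2 * v $ 1, u $ 2 * v $ 2]"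

definition msc_mult :: "'a::field ^ 4 ^ 2 \<Rightarrow> 'a ^ 2 \<Rightarrow> 'a ^ 2 \<Rightarrow> 'a ^ 2" where
  "msc_mult A u v = A *v kron u v"

definition idempotents :: "('v::zero \<Rightarrow> 'v \<Rightarrow> 'v) \<Rightarrow> 'v set" where
  "idempotents m = {v. v \<noteq> 0 \<and> m v v = v}"

definition Idem :: "'a::field ^ 4 ^ 2 \<Rightarrow> ('a ^ 2) set" where
  "Idem A = idempotents (msc_mult A)"

(* An arbitrarily chosen square root; meaningful only where one exists. *)
definition fsqrt :: "'a::field \<Rightarrow> 'a" where
  "fsqrt z = (SOME s. s\<^sup>2 = z)"

definition quadratics_cubics_have_roots :: "'a::field itself \<Rightarrow> bool" where
  "quadratics_cubics_have_roots _ \<longleftrightarrow>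
     (\<forall>p :: 'a poly. degree p = 2 \<or> degree p = 3 \<longrightarrow> (\<exists>x. poly p x = 0))"

definition msc :: "'a::field list \<Rightarrow> 'a list \<Rightarrow> 'a ^ 4 ^ 2" where
  "msc r1 r2 = vector [vector r1, vector r2]"

lemma vector_4:
  "(vector [w, x, y, z] :: 'a::zero ^ 4) $ 1 = w"
  "(vector [w, x, y, z] :: 'a::zero ^ 4) $ 2 = x"
  "(vector [w, x, y, z] :: 'a::zero ^ 4) $ 3 = y"
  "(vector [w, x, y, z] :: 'a::zero ^ 4) $ 4 = z"
  unfolding vector_def by simp_all

lemma msc_mult_basis:
  fixes A :: "'a::field ^ 4 ^ 2"
  shows "msc_mult A e1 e1 = A $ 1 $ 1 *s e1 + A $ 2 $ 1 *s e2"
    and "msc_mult A e1 e2 = A $ 1 $ 2 *s e1 + A $ 2 $ 2 *s e2"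
    and "msc_mult A e2 e1 = A $ 1 $ 3 *s e1 + A $ 2 $ 3 *s e2"
    and "msc_mult A e2 e2 = A $ 1 $ 4 *s e1 + A $ 2 $ 4 *s e2"
  by (simp_all add: vec_eq_iff forall_2 msc_mult_def kron_def e1_def e2_def axis_def
      matrix_vector_mult_def sum_4 vector_4)

lemma msc_mult_bilinear:
  fixes A :: "'a::field ^ 4 ^ 2"
  shows "Vector_Spaces.linear (*s) (*s) (msc_mult A u)"
    and "Vector_Spaces.linear (*s) (*s) (\<lambda>u. msc_mult A u v)"
  by (auto intro!: Vector_Spaces.linear.intro module_hom.intro module_hom_axioms.intro
      vec.vector_space_axioms vec.module_axioms
      simp: vec_eq_iff forall_2 msc_mult_def kron_def matrix_vector_mult_def sum_4 vector_4
      algebra_simps)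

(* Families without a suffix are those for characteristic other than 2 and 3. *)
definition A3 :: "'a::field \<Rightarrow> 'a \<Rightarrow> 'a ^ 4 ^ 2" where
  "A3 \<beta>\<^sub>1 \<beta>\<^sub>2 = msc [0, 1, 1, 0]
                [\<beta>\<^sub>1, \<beta>\<^sub>2, 1, - 1]"

definition A4 :: "'a::field \<Rightarrow> 'a \<Rightarrow> 'a ^ 4 ^ 2" where
  "A4 \<alpha>\<^sub>1 \<beta>\<^sub>2 = msc [\<alpha>\<^sub>1, 0, 0, 0]
                [0, \<beta>\<^sub>2, 1 - \<alpha>\<^sub>1, 0]"

definition A5 :: "'a::field \<Rightarrow> 'a ^ 4 ^ 2" where
  "A5 \<alpha>\<^sub>1 = msc [\<alpha>\<^sub>1, 0, 0, 0]
             [1, 2 * \<alpha>\<^sub>1 - 1, 1 - \<alpha>\<^sub>1, 0]"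

definition A7 :: "'a::field \<Rightarrow> 'a ^ 4 ^ 2" where
  "A7 \<beta>\<^sub>1 = msc [0, 1, 1, 0]
             [\<beta>\<^sub>1, 1, 0, - 1]"

definition A8 :: "'a::field \<Rightarrow> 'a ^ 4 ^ 2" where
  "A8 \<alpha>\<^sub>1 = msc [\<alpha>\<^sub>1, 0, 0, 0]
             [0, 1 - \<alpha>\<^sub>1, - \<alpha>\<^sub>1, 0]"

definition A9 :: "'a::field ^ 4 ^ 2" where
  "A9 = msc [1/3, 0, 0, 0]
           [1, 2/3, - (1/3), 0]"

definition A10 :: "'a::field ^ 4 ^ 2" where
  "A10 = msc [0, 1, 1, 0]
            [0, 0, 0, - 1]"

definition A11 :: "'a::field ^ 4 ^ 2" where
  "A11 = msc [0, 1, 1, 0]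
            [1, 0, 0, - 1]"

definition A12 :: "'a::field ^ 4 ^ 2" where
  "A12 = msc [0, 0, 0, 0]
            [1, 0, 0, 0]"

(* Families named _2 are those for characteristic 2. *)
definition A3_2 :: "'a::field \<Rightarrow> 'a \<Rightarrow> 'a ^ 4 ^ 2" where
  "A3_2 \<alpha>\<^sub>1 \<beta>\<^sub>2 = msc [\<alpha>\<^sub>1, 1, 1, 0]
                  [0, \<beta>\<^sub>2, 1 - \<alpha>\<^sub>1, 1]"

definition A4_2 :: "'a::field \<Rightarrow> 'a \<Rightarrow> 'a ^ 4 ^ 2" where
  "A4_2 \<alpha>\<^sub>1 \<beta>\<^sub>2 = msc [\<alpha>\<^sub>1, 0, 0, 0]
                  [0, \<beta>\<^sub>2, 1 - \<alpha>\<^sub>1, 0]"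

definition A5_2 :: "'a::field \<Rightarrow> 'a ^ 4 ^ 2" where
  "A5_2 \<alpha>\<^sub>1 = msc [\<alpha>\<^sub>1, 0, 0, 0]
               [1, 1, 1 - \<alpha>\<^sub>1, 0]"

definition A7_2 :: "'a::field \<Rightarrow> 'a ^ 4 ^ 2" where
  "A7_2 \<alpha>\<^sub>1 = msc [\<alpha>\<^sub>1, 1, 1, 0]
               [0, 1 - \<alpha>\<^sub>1, - \<alpha>\<^sub>1, - 1]"

definition A8_2 :: "'a::field \<Rightarrow> 'a ^ 4 ^ 2" where
  "A8_2 \<alpha>\<^sub>1 = msc [\<alpha>\<^sub>1, 0, 0, 0]
               [0, 1 - \<alpha>\<^sub>1, - \<alpha>\<^sub>1, 0]"

definition A9_2 :: "'a::field ^ 4 ^ 2" where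
  "A9_2 = msc [1, 0, 0, 0]
             [1, 0, 1, 0]"

definition A10_2 :: "'a::field ^ 4 ^ 2" where
  "A10_2 = msc [0, 1, 1, 0]
              [0, 0, 0, - 1]"

definition A11_2 :: "'a::field ^ 4 ^ 2" where
  "A11_2 = msc [1, 1, 1, 0]
              [0, - 1, - 1, - 1]"

definition A12_2 :: "'a::field ^ 4 ^ 2" where
  "A12_2 = msc [0, 0, 0, 0]
              [1, 0, 0, 0]"

(* Families named _3 are those for characteristic 3. *)
definition A3_3 :: "'a::field \<Rightarrow> 'a \<Rightarrow> 'a ^ 4 ^ 2" where
  "A3_3 \<beta>\<^sub>1 \<beta>\<^sub>2 = msc [0, 1, 1, 0]
                  [\<beta>\<^sub>1, \<beta>\<^sub>2, 1, - 1]"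

definition A4_3 :: "'a::field \<Rightarrow> 'a \<Rightarrow> 'a ^ 4 ^ 2" where
  "A4_3 \<alpha>\<^sub>1 \<beta>\<^sub>2 = msc [\<alpha>\<^sub>1, 0, 0, 0]
                  [0, \<beta>\<^sub>2, 1 - \<alpha>\<^sub>1, 0]"

definition A5_3 :: "'a::field \<Rightarrow> 'a ^ 4 ^ 2" where
  "A5_3 \<alpha>\<^sub>1 = msc [\<alpha>\<^sub>1, 0, 0, 0]
               [1, - 1 - \<alpha>\<^sub>1, 1 - \<alpha>\<^sub>1, 0]"

definition A7_3 :: "'a::field \<Rightarrow> 'a ^ 4 ^ 2" where
  "A7_3 \<beta>\<^sub>1 = msc [0, 1, 1, 0]
               [\<beta>\<^sub>1, 1, 0, - 1]"

definition A8_3 :: "'a::field \<Rightarrow> 'a ^ 4 ^ 2" where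
  "A8_3 \<alpha>\<^sub>1 = msc [\<alpha>\<^sub>1, 0, 0, 0]
               [0, 1 - \<alpha>\<^sub>1, - \<alpha>\<^sub>1, 0]"

definition A9_3 :: "'a::field ^ 4 ^ 2" where
  "A9_3 = msc [0, 1, 1, 0]
             [1, 0, 0, - 1]"

definition A10_3 :: "'a::field ^ 4 ^ 2" where
  "A10_3 = msc [0, 1, 1, 0]
              [0, 0, 0, - 1]"

definition A11_3 :: "'a::field ^ 4 ^ 2" where
  "A11_3 = msc [1, 0, 0, 0]
              [1, - 1, - 1, 0]"

definition A12_3 :: "'a::field ^ 4 ^ 2" where
  "A12_3 = msc [0, 0, 0, 0]
              [1, 0, 0, 0]"

(* In A7_2 one has e2 e2 = - e2 for every parameter value, so - e2 is always an idempotent.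
   The published list of idempotents omits it when the parameter is different from 0 and 1. *)
lemma uminus_e2_in_Idem_A7_2: "- e2 \<in> Idem (A7_2 \<alpha>\<^sub>1)"
  by (simp add: Idem_def idempotents_def vec_eq_iff forall_2 msc_mult_def kron_def e2_def axis_def
      A7_2_def msc_def matrix_vector_mult_def sum_4 vector_4)

end

theory Submission
  imports Defs
begin

text \<open>For $v = x e_1 + y e_2$ the equation $v^2 = v$ is a system of two quadratic equations in $x$ and
  $y$. Every family has first row $(\<alpha>, 0, 0, 0)$ or $(0, 1, 1, 0)$, or in characteristic 2
  $(\<alpha>, 1, 1, 0)$, so the first equation factors as $x(\<alpha> x - 1) = 0$ or $x(2y - 1) = 0$. The second
  row enters only through its outer entries and the sum of its two middle entries, and the second
  equation is then at most quadratic in the remaining coordinate.\<close>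

section \<open>Coordinates, small characteristics and square roots\<close>

lemma vec2_eq_iff: "u = v \<longleftrightarrow> u $ 1 = v $ 1 \<and> u $ 2 = v $ 2" for u v :: "'a ^ 2"
  by (simp add: vec_eq_iff forall_2)

lemma e1_e2_nth [simp]: "e1 $ 1 = 1" "e1 $ 2 = 0" "e2 $ 1 = 0" "e2 $ 2 = 1"
  by (simp_all add: e1_def e2_def axis_def)

text \<open>The two middle coordinates of \<open>kron v v\<close> coincide, so the middle columns
  act only through their sums.\<close>

lemma mem_Idem_msc_iff:
  "v \<in> Idem (msc [a1, a2, a3, a4] [b1, b2, b3, b4]) \<longleftrightarrow>
     (v $ 1 \<noteq> 0 \<or> v $ 2 \<noteq> 0) \<and>
     a1 * (v $ 1)\<^sup>2 + (a2 + a3) * (v $ 1 * v $ 2) + a4 * (v $ 2)\<^sup>2 = v $ 1 \<and>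
     b1 * (v $ 1)\<^sup>2 + (b2 + b3) * (v $ 1 * v $ 2) + b4 * (v $ 2)\<^sup>2 = v $ 2"
  by (simp add: Idem_def idempotents_def vec2_eq_iff msc_mult_def kron_def msc_def
      matrix_vector_mult_def sum_4 vector_4 power2_eq_square algebra_simps)

text \<open>2 vanishes iff the characteristic divides it; as 2 is prime and a field never has
  characteristic 1, only 2 remains. This turns the case distinction on the characteristic into
  equations in the field.\<close>

lemma two_eq_0_iff_CHAR: "(2 :: 'a::field) = 0 \<longleftrightarrow> CHAR('a) = 2"
  using of_nat_eq_0_iff_char_dvd[of 2, where 'a = 'a] CHAR_not_1[where 'a = 'a]
    two_is_prime_nat by (auto simp: prime_nat_iff)

lemma three_eq_0_iff_CHAR: "(3 :: 'a::field) = 0 \<longleftrightarrow> CHAR('a) = 3"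
proof -
  have "prime (3 :: nat)"
    by (simp add: prime_nat_numeral_eq)
  then show ?thesis
    using of_nat_eq_0_iff_char_dvd[of 3, where 'a = 'a] CHAR_not_1[where 'a = 'a]
    by (auto simp: prime_nat_iff)
qed

text \<open>A root of the quadratic X^2 - z witnesses that the choice in \<open>fsqrt\<close> is not
  arbitrary junk.\<close>

lemma fsqrt_square:
  fixes z :: "'a::field"
  assumes "quadratics_cubics_have_roots TYPE('a)"
  shows "(fsqrt z)\<^sup>2 = z"
proof -
  have "degree [:- z, 0, 1:] = 2"
    by simp
  then obtain x where "poly [:- z, 0, 1:] x = 0"
    using assms unfolding quadratics_cubics_have_roots_def by blast
  then have "x\<^sup>2 = z"
    by (simp add: power2_eq_square)
  then show ?thesis
    unfolding fsqrt_def by (rule someI)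
qed

subsection \<open>First row $(\alpha, 0, 0, 0)$\<close>

lemma Idem_row_zero: "Idem (msc [0, 0, 0, 0] [b1, b2, b3, 0]) = {}"
  by (auto simp: mem_Idem_msc_iff)

text \<open>The first equation gives x = 0 or x = 1/a, and x = 0 forces y = 0, which is excluded. At
  x = 1/a the second equation, multiplied by a^2, is linear in y. Whether \<open>b2 + b3 = a\<close>
  and whether \<open>b1 = 0\<close> then decide between no solution, one point and a line.\<close>

lemma mem_Idem_row_diag_iff:
  assumes "a \<noteq> 0"
  shows "v \<in> Idem (msc [a, 0, 0, 0] [b1, b2, b3, 0]) \<longleftrightarrow>
    v $ 1 = 1 / a \<and> b1 = (a - (b2 + b3)) * a * v $ 2"
proof -
  have "a * (v $ 1)\<^sup>2 = v $ 1 \<longleftrightarrow> v $ 1 = 0 \<or> v $ 1 = 1 / a"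
    using assms by (auto simp: power2_eq_square field_simps)
  moreover have "b1 * (1 / a)\<^sup>2 + (b2 + b3) * (1 / a * v $ 2) = v $ 2 \<longleftrightarrow>
      b1 = (a - (b2 + b3)) * a * v $ 2"
  proof -
    have "b1 * (1 / a)\<^sup>2 + (b2 + b3) * (1 / a * v $ 2) - v $ 2 =
        (b1 - (a - (b2 + b3)) * a * v $ 2) / a\<^sup>2"
      using assms by (simp add: field_simps power2_eq_square)
    then show ?thesis
      using assms by (metis divide_eq_0_iff eq_iff_diff_eq_0 power_not_zero)
  qed
  ultimately show ?thesis
    using assms by (auto simp: mem_Idem_msc_iff)
qed

text \<open>Here \<open>a = 0\<close> is allowed because the parameter of \<open>A5\<close> and its
  analogues may vanish.\<close>

lemma Idem_row_diag_empty:
  assumes "b1 \<noteq> 0" "b2 + b3 = a"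
  shows "Idem (msc [a, 0, 0, 0] [b1, b2, b3, 0]) = {}"
  using assms by (cases "a = 0") (auto simp: Idem_row_zero mem_Idem_row_diag_iff)

lemma Idem_row_diag_singleton:
  assumes "a \<noteq> 0" "b2 + b3 \<noteq> a"
  shows "Idem (msc [a, 0, 0, 0] [0, b2, b3, 0]) = {(1 / a) *s e1}"
  using assms by (auto simp: mem_Idem_row_diag_iff vec2_eq_iff)

lemma Idem_row_diag_line:
  assumes "a \<noteq> 0" "b2 + b3 = a"
  shows "Idem (msc [a, 0, 0, 0] [0, b2, b3, 0]) = {(1 / a) *s e1 + t *s e2 | t. True}"
  using assms by (auto simp: mem_Idem_row_diag_iff vec2_eq_iff)

subsection \<open>First row $(0, 1, 1, 0)$\<close>

text \<open>The first equation is x (2y - 1) = 0. On x = 0 the second becomes y (y + 1) = 0, leaving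
  only -e2. On y = 1/2, multiplying it by 4 gives the displayed equation for x, whose solution
  depends on the coefficients and on whether 3 = 0.\<close>

lemma Idem_row_swap:
  fixes b1 b2 b3 :: "'a::field"
  assumes "(2 :: 'a) \<noteq> 0"
  shows "Idem (msc [0, 1, 1, 0] [b1, b2, b3, - 1]) =
    insert (- e2) {x *s e1 + (1/2) *s e2 | x. 4 * b1 * x\<^sup>2 + 2 * (b2 + b3) * x = 3}"
proof -
  have four: "(4 :: 'a) \<noteq> 0"
    using assms by (metis mult_2 mult_eq_0_iff numeral_Bit0)
  have "(x \<noteq> 0 \<or> y \<noteq> 0) \<and> 2 * (x * y) = x \<and> b1 * x\<^sup>2 + (b2 + b3) * (x * y) - y\<^sup>2 = y \<longleftrightarrow>
      x = 0 \<and> y = - 1 \<or> y = 1 / 2 \<and> 4 * b1 * x\<^sup>2 + 2 * (b2 + b3) * x = 3" for x y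
  proof -
    have half: "y = 1 / 2 \<longleftrightarrow> 2 * y = 1"
      using assms by (auto simp: field_simps)
    have eq: "b1 * x\<^sup>2 + (b2 + b3) * (x * y) - y\<^sup>2 = y \<longleftrightarrow>
        4 * b1 * x\<^sup>2 + 2 * (b2 + b3) * x = 3" if "2 * y = 1"
    proof -
      have "4 * (b1 * x\<^sup>2 + (b2 + b3) * (x * y) - y\<^sup>2 - y) =
          4 * b1 * x\<^sup>2 + 2 * (b2 + b3) * x - 3"
        using that by algebra
      then show ?thesis
        using four by (metis eq_iff_diff_eq_0 mult_eq_0_iff)
    qed
    consider "2 * y = 1" | "2 * y \<noteq> 1" "x = 0" | "2 * y \<noteq> 1" "x \<noteq> 0"
      by blast
    then show ?thesis
    proof cases
      case 1
      \<comment> \<open>The two alternatives can overlap only if -1 = 1/2, that is 3 = 0, and then x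
        = 0 already solves the equation for x.\<close>
      have "y \<noteq> - 1" if "x = 0" "4 * b1 * x\<^sup>2 + 2 * (b2 + b3) * x \<noteq> 3"
        using that 1 by auto
      then show ?thesis
        using 1 eq half by auto
    next
      case 2
      have "- y\<^sup>2 = y \<longleftrightarrow> y * (y + 1) = 0"
        by (simp add: neg_eq_iff_add_eq_0 power2_eq_square algebra_simps)
      then show ?thesis
        using 2 half by (auto simp: eq_neg_iff_add_eq_0)
    next
      case 3
      have "2 * (x * y) = x \<longleftrightarrow> x * (2 * y - 1) = 0"
        by (auto simp: algebra_simps)
      then show ?thesis
        using 3 half by auto
    qed
  qed
  then show ?thesis
    by (auto simp: set_eq_iff mem_Idem_msc_iff vec2_eq_iff)
qed

lemma Idem_row_swap_linear:
  fixes b2 b3 :: "'a::field"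
  assumes "(2 :: 'a) \<noteq> 0" "b2 + b3 \<noteq> 0"
  shows "Idem (msc [0, 1, 1, 0] [0, b2, b3, - 1]) =
    {- e2, (3 / (2 * (b2 + b3))) *s e1 + (1/2) *s e2}"
proof -
  have "2 * (b2 + b3) \<noteq> 0"
    using assms by (metis mult_eq_0_iff)
  then have "2 * (b2 + b3) * x = 3 \<longleftrightarrow> x = 3 / (2 * (b2 + b3))" for x
    by (metis mult.commute nonzero_eq_divide_eq)
  then show ?thesis
    using assms(1) by (simp add: Idem_row_swap)
qed

text \<open>The equation for x degenerates to 0 = 3.\<close>

lemma Idem_row_swap_constant:
  fixes b2 b3 :: "'a::field"
  assumes "(2 :: 'a) \<noteq> 0" "(3 :: 'a) \<noteq> 0" "b2 + b3 = 0"
  shows "Idem (msc [0, 1, 1, 0] [0, b2, b3, - 1]) = {- e2}"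
  using assms by (auto simp: Idem_row_swap)

text \<open>The reciprocal of the first coordinate is a root of $3u^2 - 2(b_2 + b_3)u - 4b_1$, hence the
  square roots in the denominators.\<close>

lemma Idem_row_swap_quadratic:
  fixes b1 b2 b3 s :: "'a::field"
  assumes "(2 :: 'a) \<noteq> 0" "(3 :: 'a) \<noteq> 0" "b1 \<noteq> 0" "s\<^sup>2 = (b2 + b3)\<^sup>2 + 12 * b1"
  shows "Idem (msc [0, 1, 1, 0] [b1, b2, b3, - 1]) =
    {- e2, (3 / (b2 + b3 - s)) *s e1 + (1/2) *s e2, (3 / (b2 + b3 + s)) *s e1 + (1/2) *s e2}"
proof -
  define c where "c = b2 + b3"
  \<comment> \<open>The two denominators multiply to -12 b1, and 12 = 2 * 2 * 3 is nonzero, so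
    neither of them vanishes.\<close>
  have s: "(c - s) * (c + s) = - (12 * b1)"
    using assms(4) unfolding c_def by algebra
  have "(2 * 2 * 3 :: 'a) \<noteq> 0"
    using assms(1,2) by (metis mult_eq_0_iff)
  then have "(12 :: 'a) \<noteq> 0"
    by simp
  then have ne: "c - s \<noteq> 0" "c + s \<noteq> 0"
    using s assms(3) by (metis mult_eq_0_iff neg_equal_0_iff_equal)+
  have "4 * b1 * x\<^sup>2 + 2 * c * x = 3 \<longleftrightarrow> x = 3 / (c - s) \<or> x = 3 / (c + s)" for x
  proof -
    \<comment> \<open>With denominators cleared, the two candidate solutions are the zeros of this
      product, which is -3 times the quadratic.\<close>
    have "((c - s) * x - 3) * ((c + s) * x - 3) = - 3 * (4 * b1 * x\<^sup>2 + 2 * c * x - 3)"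
      using s by algebra
    then have "4 * b1 * x\<^sup>2 + 2 * c * x - 3 = 0 \<longleftrightarrow>
        (c - s) * x - 3 = 0 \<or> (c + s) * x - 3 = 0"
      using assms(2) by (metis mult_eq_0_iff neg_equal_0_iff_equal)
    then show ?thesis
      using ne by (simp add: eq_divide_eq mult.commute)
  qed
  then show ?thesis
    using assms(1) unfolding c_def by (auto simp: Idem_row_swap)
qed

text \<open>Without a linear term the equation is 4x^2 = 3, solved directly with the square root in
  the numerator.\<close>

lemma Idem_row_swap_pure_quadratic:
  fixes s :: "'a::field"
  assumes "(2 :: 'a) \<noteq> 0" "s\<^sup>2 = 3"
  shows "Idem (msc [0, 1, 1, 0] [1, 0, 0, - 1]) =
    {- e2, (s / 2) *s e1 + (1/2) *s e2, - (s / 2) *s e1 + (1/2) *s e2}"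
proof -
  have "4 * x\<^sup>2 = 3 \<longleftrightarrow> x = s / 2 \<or> x = - (s / 2)" for x
  proof -
    have "4 * x\<^sup>2 - 3 = (2 * x - s) * (2 * x + s)"
      using assms(2) by (simp add: algebra_simps power2_eq_square)
    then have "4 * x\<^sup>2 = 3 \<longleftrightarrow> 2 * x - s = 0 \<or> 2 * x + s = 0"
      by (metis eq_iff_diff_eq_0 mult_eq_0_iff)
    moreover have "x = s / 2 \<longleftrightarrow> 2 * x - s = 0" "x = - (s / 2) \<longleftrightarrow> 2 * x + s = 0"
      using assms(1) by (simp_all add: field_simps eq_neg_iff_add_eq_0)
    ultimately show ?thesis
      by blast
  qed
  then have "{x *s e1 + (1/2) *s e2 | x. 4 * 1 * x\<^sup>2 + 2 * (0 + 0) * x = 3} =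
      {(s / 2) *s e1 + (1/2) *s e2, - (s / 2) *s e1 + (1/2) *s e2}"
    by (simp only: mult_1_right add_0_left mult_zero_right mult_zero_left add_0_right) blast
  then show ?thesis
    by (simp only: Idem_row_swap[OF assms(1)])
qed

section \<open>First row (0, 1, 1, 0) in characteristic 3\<close>

lemma two_eq_minus_one_if_char3:
  assumes "(3 :: 'a::field) = 0"
  shows "(2 :: 'a) = - 1"
  using assms by (simp add: eq_neg_iff_add_eq_0)

lemma half_smult_e2_if_char3:
  assumes "(3 :: 'a::field) = 0"
  shows "x *s e1 + (1/2) *s e2 = x *s e1 - (e2 :: 'a ^ 2)"
  unfolding two_eq_minus_one_if_char3[OF assms] by (simp add: vec2_eq_iff)

text \<open>Modulo 3 the coefficients 4, 2, 3 of the equation for x become 1, -1, 0, so the constant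
  term drops out and x splits off. The root x = 0 gives -e2 again, because 1/2 = -1.\<close>

lemma Idem_row_swap_char3:
  fixes b1 b2 b3 :: "'a::field"
  assumes "(3 :: 'a) = 0"
  shows "Idem (msc [0, 1, 1, 0] [b1, b2, b3, - 1]) =
    insert (- e2) {x *s e1 - e2 | x. x * (b1 * x - (b2 + b3)) = 0}"
proof -
  have two: "(2 :: 'a) \<noteq> 0"
    unfolding two_eq_minus_one_if_char3[OF assms] by simp
  have "4 * b1 * x\<^sup>2 + 2 * (b2 + b3) * x = 3 \<longleftrightarrow> x * (b1 * x - (b2 + b3)) = 0" for x
  proof -
    have "4 * b1 * x\<^sup>2 + 2 * (b2 + b3) * x - 3 =
        x * (b1 * x - (b2 + b3)) + 3 * (b1 * x\<^sup>2 + (b2 + b3) * x - 1)"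
      by (simp add: algebra_simps power2_eq_square)
    then show ?thesis
      using assms by simp
  qed
  then show ?thesis
    by (simp only: Idem_row_swap[OF two] half_smult_e2_if_char3[OF assms])
qed

lemma Idem_row_swap_char3_nonlinear:
  fixes b1 b2 b3 :: "'a::field"
  assumes "(3 :: 'a) = 0" "b1 \<noteq> 0"
  shows "Idem (msc [0, 1, 1, 0] [b1, b2, b3, - 1]) = {((b2 + b3) / b1) *s e1 - e2, - e2}"
  using assms by (auto simp: Idem_row_swap_char3 vec2_eq_iff eq_divide_eq mult.commute)

lemma Idem_row_swap_char3_linear:
  fixes b2 b3 :: "'a::field"
  assumes "(3 :: 'a) = 0" "b2 + b3 \<noteq> 0"
  shows "Idem (msc [0, 1, 1, 0] [0, b2, b3, - 1]) = {- e2}"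
  using assms by (auto simp: Idem_row_swap_char3 vec2_eq_iff)

lemma Idem_row_swap_char3_line:
  fixes b2 b3 :: "'a::field"
  assumes "(3 :: 'a) = 0" "b2 + b3 = 0"
  shows "Idem (msc [0, 1, 1, 0] [0, b2, b3, - 1]) = {t *s e1 - e2 | t. True}"
  using assms by (auto simp: Idem_row_swap_char3 vec2_eq_iff)

subsection \<open>First row $(\alpha, 1, 1, 0)$ in characteristic 2\<close>

lemma uminus_eq_self_if_char2:
  fixes x :: "'a::field"
  assumes "(2 :: 'a) = 0"
  shows "- x = x"
  using assms by (simp add: neg_eq_iff_add_eq_0 flip: mult_2)

lemma uminus_vec_eq_self_if_char2:
  fixes v :: "'a::field ^ 'n"
  assumes "(2 :: 'a) = 0"
  shows "- v = v"
  using uminus_eq_self_if_char2[OF assms] by (simp add: vec_eq_iff)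

lemma add_eq_0_iff_if_char2:
  fixes x y :: "'a::field"
  assumes "(2 :: 'a) = 0"
  shows "x + y = 0 \<longleftrightarrow> x = y"
  using uminus_eq_self_if_char2[OF assms] by (metis neg_eq_iff_add_eq_0)

text \<open>The cross term 2xy of the first equation vanishes, leaving x (a x - 1) = 0. The second
  equation factors in y once the sign of its cross term is flipped. On x = 0 the root y = 0 is
  excluded; on a x = 1 both roots survive.\<close>

lemma mem_Idem_row_char2_iff:
  fixes a b2 b3 :: "'a::field"
  assumes "(2 :: 'a) = 0"
  shows "v \<in> Idem (msc [a, 1, 1, 0] [0, b2, b3, 1]) \<longleftrightarrow>
    v $ 1 = 0 \<and> v $ 2 = 1 \<or>
    a * v $ 1 = 1 \<and> (v $ 2 = 0 \<or> v $ 2 = 1 + (b2 + b3) * v $ 1)"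
proof -
  have "a * x\<^sup>2 + (1 + 1) * (x * y) = x \<longleftrightarrow> x * (a * x - 1) = 0"
    and "(b2 + b3) * (x * y) + y\<^sup>2 = y \<longleftrightarrow> y * (y - (1 + (b2 + b3) * x)) = 0" for x y
  proof -
    show "a * x\<^sup>2 + (1 + 1) * (x * y) = x \<longleftrightarrow> x * (a * x - 1) = 0"
      using assms by (simp add: power2_eq_square algebra_simps)
    have "- ((b2 + b3) * (x * y)) = (b2 + b3) * (x * y)"
      by (rule uminus_eq_self_if_char2[OF assms])
    then have "(b2 + b3) * (x * y) + y\<^sup>2 - y = y * (y - (1 + (b2 + b3) * x))"
      by (simp add: power2_eq_square algebra_simps)
    then show "(b2 + b3) * (x * y) + y\<^sup>2 = y \<longleftrightarrow> y * (y - (1 + (b2 + b3) * x)) = 0"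
      by (metis eq_iff_diff_eq_0)
  qed
  then show ?thesis
    by (auto simp: mem_Idem_msc_iff)
qed

lemma Idem_row_char2_zero:
  fixes b2 b3 :: "'a::field"
  assumes "(2 :: 'a) = 0"
  shows "Idem (msc [0, 1, 1, 0] [0, b2, b3, 1]) = {e2}"
  by (auto simp: mem_Idem_row_char2_iff[OF assms] vec2_eq_iff)

lemma Idem_row_char2:
  fixes a b2 b3 :: "'a::field"
  assumes "(2 :: 'a) = 0" "a \<noteq> 0"
  shows "Idem (msc [a, 1, 1, 0] [0, b2, b3, 1]) =
    {e2, (1 / a) *s e1, (1 / a) *s e1 + (1 + (b2 + b3) / a) *s e2}"
proof -
  have "a * x = 1 \<longleftrightarrow> x = 1 / a" for x
    using assms(2) by (auto simp: field_simps)
  then show ?thesis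
    by (auto simp: mem_Idem_row_char2_iff[OF assms(1)] vec2_eq_iff)
qed

text \<open>Since -1 = 1, this family falls under \<open>Idem_row_char2\<close>. At a = 1 the last
  two points coincide.\<close>

lemma Idem_A7_2:
  fixes a :: "'a::field"
  assumes "(2 :: 'a) = 0" "a \<noteq> 0"
  shows "Idem (A7_2 a) = {- e2, (1 / a) *s e1, (1 / a) *s e1 + ((1 - a) / a) *s e2}"
proof -
  have "A7_2 a = msc [a, 1, 1, 0] [0, 1 - a, - a, 1]"
    using uminus_eq_self_if_char2[OF assms(1), of 1] by (simp only: A7_2_def)
  moreover have "1 + (1 - a + - a) / a = (1 - a) / a"
    using assms(2) by (simp add: diff_divide_distrib)
  ultimately show ?thesis
    using Idem_row_char2[OF assms, of "1 - a" "- a"] uminus_vec_eq_self_if_char2[OF assms(1), of e2]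
    by (simp only:)
qed

section \<open>Specialization to the individual families\<close>

theorem theorem4p2:
  assumes "quadratics_cubics_have_roots TYPE('a::field)"
  shows
    "(CHAR('a) \<noteq> 2 \<and> CHAR('a) \<noteq> 3 \<longrightarrow>
        (\<forall>\<beta>\<^sub>2 :: 'a. Idem (A4 0 \<beta>\<^sub>2) = {}) \<and>
        (\<forall>\<alpha>\<^sub>1 :: 'a. Idem (A5 \<alpha>\<^sub>1) = {}) \<and>
        Idem (A8 (0 :: 'a)) = {} \<and>
        Idem (A9 :: 'a ^ 4 ^ 2) = {} \<and>
        Idem (A12 :: 'a ^ 4 ^ 2) = {} \<and>
        Idem (A3 (0 :: 'a) (- 1)) = {- e2} \<and>
        (\<forall>\<beta>\<^sub>2 :: 'a. \<beta>\<^sub>2 \<noteq> - 1 \<longrightarrow>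
          Idem (A3 0 \<beta>\<^sub>2) = {- e2, (3 / (2 * (\<beta>\<^sub>2 + 1))) *s e1 + (1/2) *s e2}) \<and>
        (\<forall>\<beta>\<^sub>1 \<beta>\<^sub>2 :: 'a. \<beta>\<^sub>1 \<noteq> 0 \<longrightarrow>
          Idem (A3 \<beta>\<^sub>1 \<beta>\<^sub>2) =
            {- e2,
             (3 / (\<beta>\<^sub>2 + 1 - fsqrt ((\<beta>\<^sub>2 + 1)\<^sup>2 + 12 * \<beta>\<^sub>1))) *s e1 + (1/2) *s e2,
             (3 / (\<beta>\<^sub>2 + 1 + fsqrt ((\<beta>\<^sub>2 + 1)\<^sup>2 + 12 * \<beta>\<^sub>1))) *s e1 + (1/2) *s e2}) \<and>
        (\<forall>\<alpha>\<^sub>1 \<beta>\<^sub>2 :: 'a. \<alpha>\<^sub>1 \<noteq> 0 \<and> \<beta>\<^sub>2 \<noteq> 2 * \<alpha>\<^sub>1 - 1 \<longrightarrow> Idem (A4 \<alpha>\<^sub>1 \<beta>\<^sub>2) = {(1 / \<alpha>\<^sub>1) *s e1}) \<and>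
        (\<forall>\<alpha>\<^sub>1 :: 'a. \<alpha>\<^sub>1 \<noteq> 0 \<longrightarrow> Idem (A4 \<alpha>\<^sub>1 (2 * \<alpha>\<^sub>1 - 1)) = {(1 / \<alpha>\<^sub>1) *s e1 + t *s e2 | t. True}) \<and>
        Idem (A7 (0 :: 'a)) = {- e2, (3/2) *s e1 + (1/2) *s e2} \<and>
        (\<forall>\<beta>\<^sub>1 :: 'a. \<beta>\<^sub>1 \<noteq> 0 \<longrightarrow>
          Idem (A7 \<beta>\<^sub>1) =
            {- e2,
             (3 / (1 - fsqrt (12 * \<beta>\<^sub>1 + 1))) *s e1 + (1/2) *s e2,
             (3 / (1 + fsqrt (12 * \<beta>\<^sub>1 + 1))) *s e1 + (1/2) *s e2}) \<and>
        (\<forall>\<alpha>\<^sub>1 :: 'a. \<alpha>\<^sub>1 * (3 * \<alpha>\<^sub>1 - 1) \<noteq> 0 \<longrightarrow> Idem (A8 \<alpha>\<^sub>1) = {(1 / \<alpha>\<^sub>1) *s e1}) \<and>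
        Idem (A8 (1/3 :: 'a)) = {3 *s e1 + t *s e2 | t. True} \<and>
        Idem (A10 :: 'a ^ 4 ^ 2) = {- e2} \<and>
        Idem (A11 :: 'a ^ 4 ^ 2) = {- e2, (fsqrt 3 / 2) *s e1 + (1/2) *s e2, - (fsqrt 3 / 2) *s e1 + (1/2) *s e2}) \<and>
     (CHAR('a) = 2 \<longrightarrow>
        (\<forall>\<beta>\<^sub>2 :: 'a. Idem (A4_2 0 \<beta>\<^sub>2) = {}) \<and>
        (\<forall>\<alpha>\<^sub>1 :: 'a. Idem (A5_2 \<alpha>\<^sub>1) = {}) \<and>
        Idem (A8_2 (0 :: 'a)) = {} \<and>
        Idem (A9_2 :: 'a ^ 4 ^ 2) = {} \<and>
        Idem (A12_2 :: 'a ^ 4 ^ 2) = {} \<and>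
        (\<forall>\<beta>\<^sub>2 :: 'a. Idem (A3_2 0 \<beta>\<^sub>2) = {e2}) \<and>
        (\<forall>\<alpha>\<^sub>1 :: 'a. \<alpha>\<^sub>1 \<noteq> 0 \<longrightarrow> Idem (A3_2 \<alpha>\<^sub>1 1) = {e2, (1 / \<alpha>\<^sub>1) *s e1}) \<and>
        (\<forall>\<alpha>\<^sub>1 \<beta>\<^sub>2 :: 'a. \<beta>\<^sub>2 \<noteq> 1 \<and> \<alpha>\<^sub>1 \<noteq> 0 \<longrightarrow>
          Idem (A3_2 \<alpha>\<^sub>1 \<beta>\<^sub>2) =
            {e2, (1 / \<alpha>\<^sub>1) *s e1, (1 / \<alpha>\<^sub>1) *s (e1 + (\<beta>\<^sub>2 + 1) *s e2)}) \<and>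
        (\<forall>\<alpha>\<^sub>1 \<beta>\<^sub>2 :: 'a. \<alpha>\<^sub>1 \<noteq> 0 \<and> \<beta>\<^sub>2 \<noteq> 1 \<longrightarrow> Idem (A4_2 \<alpha>\<^sub>1 \<beta>\<^sub>2) = {(1 / \<alpha>\<^sub>1) *s e1}) \<and>
        (\<forall>\<alpha>\<^sub>1 :: 'a. \<alpha>\<^sub>1 \<noteq> 0 \<longrightarrow> Idem (A4_2 \<alpha>\<^sub>1 1) = {(1 / \<alpha>\<^sub>1) *s e1 + t *s e2 | t. True}) \<and>
        Idem (A7_2 (0 :: 'a)) = {- e2} \<and>
        Idem (A7_2 (1 :: 'a)) = {e1, - e2} \<and>
        (\<forall>\<alpha>\<^sub>1 :: 'a. \<alpha>\<^sub>1 \<noteq> 0 \<and> \<alpha>\<^sub>1 \<noteq> 1 \<longrightarrow>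
          Idem (A7_2 \<alpha>\<^sub>1) =
            {- e2, (1 / \<alpha>\<^sub>1) *s e1, (1 / \<alpha>\<^sub>1) *s e1 + ((1 - \<alpha>\<^sub>1) / \<alpha>\<^sub>1) *s e2}) \<and>
        (\<forall>\<alpha>\<^sub>1 :: 'a. \<alpha>\<^sub>1 \<noteq> 0 \<and> \<alpha>\<^sub>1 \<noteq> 1 \<longrightarrow> Idem (A8_2 \<alpha>\<^sub>1) = {(1 / \<alpha>\<^sub>1) *s e1}) \<and>
        Idem (A8_2 (1 :: 'a)) = {e1 + t *s e2 | t. True} \<and>
        Idem (A10_2 :: 'a ^ 4 ^ 2) = {e2} \<and>
        Idem (A11_2 :: 'a ^ 4 ^ 2) = {e1, - e1 + e2, - e2}) \<and>
     (CHAR('a) = 3 \<longrightarrow>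
        (\<forall>\<beta>\<^sub>2 :: 'a. Idem (A4_3 0 \<beta>\<^sub>2) = {}) \<and>
        (\<forall>\<alpha>\<^sub>1 :: 'a. Idem (A5_3 \<alpha>\<^sub>1) = {}) \<and>
        Idem (A8_3 (0 :: 'a)) = {} \<and>
        Idem (A11_3 :: 'a ^ 4 ^ 2) = {} \<and>
        Idem (A12_3 :: 'a ^ 4 ^ 2) = {} \<and>
        (\<forall>\<beta>\<^sub>2 :: 'a. \<beta>\<^sub>2 \<noteq> - 1 \<longrightarrow> Idem (A3_3 0 \<beta>\<^sub>2) = {- e2}) \<and>
        (\<forall>\<beta>\<^sub>1 \<beta>\<^sub>2 :: 'a. \<beta>\<^sub>1 \<noteq> 0 \<longrightarrow> Idem (A3_3 \<beta>\<^sub>1 \<beta>\<^sub>2) = {((1 + \<beta>\<^sub>2) / \<beta>\<^sub>1) *s e1 - e2, - e2}) \<and>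
        Idem (A3_3 (0 :: 'a) (- 1)) = {t *s e1 + (1/2) *s e2 | t. True} \<union> {- e2} \<and>
        (\<forall>\<alpha>\<^sub>1 \<beta>\<^sub>2 :: 'a. \<alpha>\<^sub>1 \<noteq> 0 \<and> \<beta>\<^sub>2 \<noteq> 2 * \<alpha>\<^sub>1 - 1 \<longrightarrow> Idem (A4_3 \<alpha>\<^sub>1 \<beta>\<^sub>2) = {(1 / \<alpha>\<^sub>1) *s e1}) \<and>
        (\<forall>\<alpha>\<^sub>1 :: 'a. \<alpha>\<^sub>1 \<noteq> 0 \<longrightarrow> Idem (A4_3 \<alpha>\<^sub>1 (2 * \<alpha>\<^sub>1 - 1)) = {(1 / \<alpha>\<^sub>1) *s e1 + t *s e2 | t. True}) \<and>
        Idem (A7_3 (0 :: 'a)) = {- e2} \<and>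
        (\<forall>\<beta>\<^sub>1 :: 'a. \<beta>\<^sub>1 \<noteq> 0 \<longrightarrow> Idem (A7_3 \<beta>\<^sub>1) = {(1 / \<beta>\<^sub>1) *s e1 - e2, - e2}) \<and>
        (\<forall>\<alpha>\<^sub>1 :: 'a. \<alpha>\<^sub>1 \<noteq> 0 \<longrightarrow> Idem (A8_3 \<alpha>\<^sub>1) = {(1 / \<alpha>\<^sub>1) *s e1}) \<and>
        Idem (A9_3 :: 'a ^ 4 ^ 2) = {- e2} \<and>
        Idem (A10_3 :: 'a ^ 4 ^ 2) = {t *s e1 - e2 | t. True})"
proof -
  note roots = fsqrt_square[OF assms]
  show ?thesis
    unfolding two_eq_0_iff_CHAR[symmetric] three_eq_0_iff_CHAR[symmetric]
  \<comment> \<open>Cases 1 to 16 treat characteristic other than 2 and 3, cases 17 to 33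
    characteristic 2, and cases 34 to 48 characteristic 3.\<close>
  proof (intro conjI impI allI, goal_cases)
    case 1
    then show ?case
      by (simp add: A4_def Idem_row_zero)
  next
    case 2
    then show ?case
      by (simp add: A5_def Idem_row_diag_empty)
  next
    case 3
    then show ?case
      by (simp add: A8_def Idem_row_zero)
  next
    case 4
    then show ?case
      by (simp add: A9_def Idem_row_diag_empty)
  next
    case 5
    then show ?case
      by (simp add: A12_def Idem_row_zero)
  next
    case 6
    then show ?case
      by (simp add: A3_def Idem_row_swap_constant)
  next
    case 7
    then show ?case
      by (simp add: A3_def Idem_row_swap_linear eq_neg_iff_add_eq_0)
  next
    case 8
    then show ?case
      by (simp add: A3_def Idem_row_swap_quadratic roots)
  next
    case 9
    then show ?case
      unfolding A4_def by (intro Idem_row_diag_singleton; simp add: algebra_simps)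
  next
    case 10
    then show ?case
      unfolding A4_def by (intro Idem_row_diag_line; simp)
  next
    case 11
    then show ?case
      by (simp add: A7_def Idem_row_swap_linear)
  next
    case (12 b)
    then show ?case
      \<comment> \<open>With middle sum 1 the radicand is 1 + 12 b, the statement's radicand with
        its summands exchanged.\<close>
      using Idem_row_swap_quadratic[where ?b1.0 = b and ?b2.0 = 1 and ?b3.0 = 0
          and s = "fsqrt (12 * b + 1)"]
      by (simp add: A7_def roots)
  next
    case 13
    then show ?case
      unfolding A8_def by (intro Idem_row_diag_singleton; simp add: algebra_simps)
  next
    case 14
    \<comment> \<open>The middle sum 1 - 2a equals a exactly at a = 1/3, where the single point
      becomes a line.\<close>
    then have "1 - 1 / 3 + - (1 / 3) = (1 / 3 :: 'a)"
      by (simp add: field_simps)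
    then show ?case
      unfolding A8_def using 14 Idem_row_diag_line[of "1 / 3 :: 'a" "1 - 1 / 3" "- (1 / 3)"] by simp
  next
    case 15
    then show ?case
      by (simp add: A10_def Idem_row_swap_constant)
  next
    case 16
    then show ?case
      unfolding A11_def by (intro Idem_row_swap_pure_quadratic roots; simp)
  next
    case 17
    then show ?case
      by (simp add: A4_2_def Idem_row_zero)
  next
    case 18
    then show ?case
      unfolding A5_2_def by (intro Idem_row_diag_empty; simp)
  next
    case 19
    then show ?case
      by (simp add: A8_2_def Idem_row_zero)
  next
    case 20
    then show ?case
      by (simp add: A9_2_def Idem_row_diag_empty)
  next
    case 21
    then show ?case
      by (simp add: A12_2_def Idem_row_zero)
  next
    case 22
    then show ?case
      by (simp add: A3_2_def Idem_row_char2_zero)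
  next
    case (23 a)
    \<comment> \<open>This second coordinate equals 2 / a = 0, so the third point merges with the
      second.\<close>
    then have "1 + (1 + (1 - a)) / a = 0"
      by (simp add: add_divide_distrib diff_divide_distrib)
    then show ?case
      using 23 by (simp add: A3_2_def Idem_row_char2)
  next
    case (24 a b)
    then have "(1 / a) *s (e1 + (b + 1) *s e2) = (1 / a) *s e1 + (1 + (b + (1 - a)) / a) *s e2"
      by (simp add: vec2_eq_iff add_divide_distrib diff_divide_distrib)
    then show ?case
      using 24 by (simp add: A3_2_def Idem_row_char2)
  next
    case (25 a b)
    \<comment> \<open>Dropping 2a leaves b + 1, which vanishes only for b = 1.\<close>
    have "b + (1 - a) - a = b + 1 - 2 * a"
      by simp
    then have "b + (1 - a) \<noteq> a"
      using 25 add_eq_0_iff_if_char2[of b 1] by auto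
    then show ?case
      unfolding A4_2_def using 25 by (intro Idem_row_diag_singleton; simp)
  next
    case 26
    then show ?case
      unfolding A4_2_def by (intro Idem_row_diag_line; simp)
  next
    case 27
    then show ?case
      by (simp add: A7_2_def Idem_row_char2_zero uminus_eq_self_if_char2 uminus_vec_eq_self_if_char2)
  next
    case 28
    then show ?case
      by (simp add: Idem_A7_2 insert_commute)
  next
    case 29
    then show ?case
      by (simp add: Idem_A7_2)
  next
    case 30
    then show ?case
      unfolding A8_2_def by (intro Idem_row_diag_singleton; simp add: algebra_simps)
  next
    case 31
    then have "1 - 1 + - 1 = (1 :: 'a)"
      by (simp only: diff_self add_0_left uminus_eq_self_if_char2)
    then show ?case
      using Idem_row_diag_line[of "1 :: 'a" "1 - 1" "- 1"] by (simp add: A8_2_def)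
  next
    case 32
    have "A10_2 = msc [0, 1, 1, 0 :: 'a] [0, 0, 0, 1]"
      by (simp only: A10_2_def uminus_eq_self_if_char2[OF 32])
    then show ?case
      using Idem_row_char2_zero[OF 32, of 0 0] by (simp only:)
  next
    case 33
    then have "A11_2 = msc [1, 1, 1, 0 :: 'a] [0, 1, 1, 1]"
      by (simp only: A11_2_def uminus_eq_self_if_char2)
    moreover have "1 + (1 + 1) / 1 = (1 :: 'a)"
      using 33 by simp
    moreover have "{e1, - e1 + e2, - e2 :: 'a ^ 2} = {e2, e1, e1 + e2}"
      unfolding uminus_vec_eq_self_if_char2[OF 33] by blast
    ultimately show ?case
      using Idem_row_char2[OF 33, of 1 1 1] by simp
  next
    case 34
    then show ?case
      by (simp add: A4_3_def Idem_row_zero)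
  next
    case (35 a)
    \<comment> \<open>The middle sum differs from a by a multiple of 3.\<close>
    have "- 1 - a + (1 - a) - a = - (3 * a)"
      by simp
    then have "- 1 - a + (1 - a) = a"
      using 35 by simp
    then show ?case
      unfolding A5_3_def by (intro Idem_row_diag_empty; simp)
  next
    case 36
    then show ?case
      by (simp add: A8_3_def Idem_row_zero)
  next
    case 37
    have "- 1 + - 1 - 1 = - (3 :: 'a)"
      by simp
    then have "- 1 + - 1 = (1 :: 'a)"
      unfolding 37 by simp
    then show ?case
      unfolding A11_3_def by (intro Idem_row_diag_empty one_neq_zero)
  next
    case 38
    then show ?case
      by (simp add: A12_3_def Idem_row_zero)
  next
    case 39
    then show ?case
      by (simp add: A3_3_def Idem_row_swap_char3_linear eq_neg_iff_add_eq_0)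
  next
    case 40
    then show ?case
      by (simp add: A3_3_def Idem_row_swap_char3_nonlinear add.commute)
  next
    case 41
    \<comment> \<open>The separately listed point is the one with t = 0 on the line.\<close>
    have "- e2 \<in> {t *s e1 - (e2 :: 'a ^ 2) | t. True}"
      by (auto intro!: exI[of _ 0])
    then show ?case
      using Idem_row_swap_char3_line[OF 41, of "- 1" 1]
      unfolding A3_3_def half_smult_e2_if_char3[OF 41] by auto
  next
    case 42
    then show ?case
      unfolding A4_3_def by (intro Idem_row_diag_singleton; simp add: algebra_simps)
  next
    case 43
    then show ?case
      unfolding A4_3_def by (intro Idem_row_diag_line; simp)
  next
    case 44
    then show ?case
      by (simp add: A7_3_def Idem_row_swap_char3_linear)
  next
    case 45
    then show ?case
      by (simp add: A7_3_def Idem_row_swap_char3_nonlinear)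
  next
    case (46 a)
    \<comment> \<open>In characteristic 3 this difference is 1, so the exceptional line does not
      occur.\<close>
    have "1 - a + - a - a = 1 - 3 * a"
      by simp
    then have "1 - a + - a \<noteq> a"
      using 46 by auto
    then show ?case
      unfolding A8_3_def using 46 by (intro Idem_row_diag_singleton)
  next
    case 47
    then show ?case
      \<comment> \<open>The middle sum is 0, so both points of the general formula are -e2.\<close>
      by (simp add: A9_3_def Idem_row_swap_char3_nonlinear)
  next
    case 48
    then show ?case
      by (simp add: A10_3_def Idem_row_swap_char3_line)
  qed
qed

end
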